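(* Let $X \xrightarrow{f} Z \xleftarrow{g} Y$ be continuous maps. (1) If $u\colon X'\to X$ and $v\colon Y'\to Y$ are continuous maps, then $\mathrm{TC}_H(f\circ u,\,g\circ v)\le \mathrm{TC}_H(f,g)$. (2) If $w\colon Z\to Z'$ is a continuous map, then $\mathrm{TC}_H(w\circ f,\,w\circ g)\le \mathrm{TC}_H(f,g)$.
   Context: All maps are continuous, $I=[0,1]$, and $Z^I$ is the path space with the compact-open topology. For maps $f\colon X\to Z$, $g\colon Y\to Z$, a subset $A\subseteq X\times Y$ is $(f,g)$-sectional if there is a continuous map $\sigma\colon A\to Z^I$ with $\sigma(x,y)(0)=f(x)$ and $\sigma(x,y)(1)=g(y)$ for all $(x,y)\in A$. The homotopy bivariate topological complexity $\mathrm{TC}_H(f,g)$ is the least integer $k\ge 0$ such that $X\times Y$ can be covered by $k+1$ open $(f,g)$-sectional subsets, and $\infty$ if no such $k$ exists. *)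

theory Defs
  imports "HOL-Analysis.Analysis"
begin

text \<open>
  Spaces are values of type \<^typ>\<open>'a topology\<close>, so that arbitrary topological spaces, including
  the empty one, are covered.  A continuous map is a function of the underlying types of which only
  the restriction to the \<^const>\<open>topspace\<close> matters; to obtain function spaces whose points are
  really the continuous maps, their elements are required to be \<^const>\<open>extensional\<close>.
\<close>

definition continuous_maps :: "'a topology \<Rightarrow> 'b topology \<Rightarrow> ('a \<Rightarrow> 'b) set" where
  "continuous_maps X Z = {\<gamma>. continuous_map X Z \<gamma> \<and> \<gamma> \<in> extensional (topspace X)}"

definition compact_open_topology :: "'a topology \<Rightarrow> 'b topology \<Rightarrow> ('a \<Rightarrow> 'b) topology" where
  "compact_open_topology X Z =
     topology_generated_by
       {{\<gamma> \<in> continuous_maps X Z. \<gamma> ` K \<subseteq> U} | K U. compactin X K \<and> openin Z U}"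

lemma topspace_compact_open_topology [simp]:
  "topspace (compact_open_topology X Z) = continuous_maps X Z"
proof -
  have "continuous_maps X Z = {\<gamma> \<in> continuous_maps X Z. \<gamma> ` {} \<subseteq> {}}"
    by simp
  moreover have "compactin X {}" "openin Z {}"
    by simp_all
  ultimately have "continuous_maps X Z \<in>
      {{\<gamma> \<in> continuous_maps X Z. \<gamma> ` K \<subseteq> U} | K U. compactin X K \<and> openin Z U}"
    by blast
  then show ?thesis
    unfolding compact_open_topology_def topology_generated_by_topspace by blast
qed

definition path_space :: "'c topology \<Rightarrow> (real \<Rightarrow> 'c) topology" where
  "path_space Z = compact_open_topology (top_of_set {0..1}) Z"

definition sectional ::
    "'a topology \<Rightarrow> 'b topology \<Rightarrow> 'c topology \<Rightarrow> ('a \<Rightarrow> 'c) \<Rightarrow> ('b \<Rightarrow> 'c) \<Rightarrow> ('a \<times> 'b) set \<Rightarrow> bool" where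
  "sectional X Y Z f g A \<longleftrightarrow>
     A \<subseteq> topspace X \<times> topspace Y \<and>
     (\<exists>\<sigma>. continuous_map (subtopology (prod_topology X Y) A) (path_space Z) \<sigma> \<and>
          (\<forall>(x, y) \<in> A. \<sigma> (x, y) 0 = f x \<and> \<sigma> (x, y) 1 = g y))"

text \<open>The family \<open>U\<close> consists of the \<open>k + 1\<close> sets \<open>U 0, \<dots>, U k\<close>, possibly with repetitions.\<close>

definition has_sectional_cover ::
    "'a topology \<Rightarrow> 'b topology \<Rightarrow> 'c topology \<Rightarrow> ('a \<Rightarrow> 'c) \<Rightarrow> ('b \<Rightarrow> 'c) \<Rightarrow> nat \<Rightarrow> bool" where
  "has_sectional_cover X Y Z f g k \<longleftrightarrow>
     (\<exists>U :: nat \<Rightarrow> ('a \<times> 'b) set.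
        (\<forall>i\<le>k. openin (prod_topology X Y) (U i) \<and> sectional X Y Z f g (U i)) \<and>
        topspace X \<times> topspace Y = (\<Union>i\<le>k. U i))"

definition TC_H ::
    "'a topology \<Rightarrow> 'b topology \<Rightarrow> 'c topology \<Rightarrow> ('a \<Rightarrow> 'c) \<Rightarrow> ('b \<Rightarrow> 'c) \<Rightarrow> enat" where
  "TC_H X Y Z f g =
     (if \<exists>k. has_sectional_cover X Y Z f g k
      then enat (LEAST k. has_sectional_cover X Y Z f g k) else \<infinity>)"

end

theory Submission
  imports Defs
begin

text \<open>
  Both inequalities hold because sectional covers can be transported, keeping the number of sets.
  For (1), the preimage of an open \<open>(f, g)\<close>-sectional set under \<open>u \<times> v\<close> is an open
  \<open>(f \<circ> u, g \<circ> v)\<close>-sectional set: precompose the section with \<open>u \<times> v\<close>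
  (\<open>sectional_precompose\<close>).  For (2), every \<open>(f, g)\<close>-sectional set is already
  \<open>(w \<circ> f, w \<circ> g)\<close>-sectional: compose the section with the map that \<open>w\<close> induces on path
  spaces (\<open>sectional_postcompose\<close>), which is continuous by functoriality of the compact-open
  topology (\<open>continuous_map_compact_open_postcompose\<close>).
\<close>

text \<open>
  Since \<open>continuous_maps X Z\<close> consists of extensional functions, composites have to be restricted
  to \<open>topspace X\<close>.
\<close>

lemma continuous_maps_postcompose:
  assumes w: "continuous_map Z Z' w" and \<gamma>: "\<gamma> \<in> continuous_maps X Z"
  shows "restrict (w \<circ> \<gamma>) (topspace X) \<in> continuous_maps X Z'"
proof -
  have "continuous_map X Z' (w \<circ> \<gamma>)"
    using w \<gamma> by (auto simp: continuous_maps_def intro: continuous_map_compose)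
  then have "continuous_map X Z' (restrict (w \<circ> \<gamma>) (topspace X))"
    by (rule continuous_map_eq) simp
  then show ?thesis
    by (simp add: continuous_maps_def)
qed

lemma continuous_map_compact_open_postcompose:
  assumes w: "continuous_map Z Z' w"
  shows "continuous_map (compact_open_topology X Z) (compact_open_topology X Z')
           (\<lambda>\<gamma>. restrict (w \<circ> \<gamma>) (topspace X))"
    (is "continuous_map ?C ?C' ?W")
proof -
  let ?B = "{{\<gamma> \<in> continuous_maps X Z'. \<gamma> ` K \<subseteq> U} | K U. compactin X K \<and> openin Z' U}"
  have "openin ?C (?W -` V \<inter> topspace ?C)" if "V \<in> ?B" for V
  proof -
    from that obtain K U where V: "V = {\<gamma> \<in> continuous_maps X Z'. \<gamma> ` K \<subseteq> U}"
      and K: "compactin X K" and U: "openin Z' U"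
      by blast
    let ?U = "{z \<in> topspace Z. w z \<in> U}"
    have KX: "K \<subseteq> topspace X"
      using K by (rule compactin_subset_topspace)
    have "?W \<gamma> \<in> V \<longleftrightarrow> \<gamma> ` K \<subseteq> ?U" if \<gamma>: "\<gamma> \<in> continuous_maps X Z" for \<gamma>
    proof -
      have "\<gamma> x \<in> topspace Z" if "x \<in> K" for x
        using \<gamma> KX that by (auto simp: continuous_maps_def continuous_map_def)
      then show ?thesis
        using continuous_maps_postcompose[OF w \<gamma>] KX unfolding V by (auto simp: subset_iff)
    qed
    \<comment> \<open>The preimage of a subbasic set is again subbasic.\<close>
    then have "?W -` V \<inter> topspace ?C = {\<gamma> \<in> continuous_maps X Z. \<gamma> ` K \<subseteq> ?U}"
      by auto
    moreover have "openin Z ?U"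
      using w U by (rule openin_continuous_map_preimage)
    ultimately show ?thesis
      unfolding compact_open_topology_def using K
      by (auto intro!: topology_generated_by_Basis)
  qed
  moreover have "?W ` topspace ?C \<subseteq> \<Union>?B"
  proof -
    have "\<Union>?B = continuous_maps X Z'"
      using topspace_compact_open_topology[of X Z']
      unfolding compact_open_topology_def topology_generated_by_topspace .
    then show ?thesis
      using continuous_maps_postcompose[OF w] by auto
  qed
  ultimately show ?thesis
    unfolding compact_open_topology_def[of X Z'] by (intro continuous_on_generated_topo)
qed

lemma sectional_postcompose:
  assumes w: "continuous_map Z Z' w" and A: "sectional X Y Z f g A"
  shows "sectional X Y Z' (w \<circ> f) (w \<circ> g) A"
proof -
  obtain \<sigma> where \<sigma>: "continuous_map (subtopology (prod_topology X Y) A) (path_space Z) \<sigma>"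
    and ends: "\<forall>(x, y) \<in> A. \<sigma> (x, y) 0 = f x \<and> \<sigma> (x, y) 1 = g y"
    using A unfolding sectional_def by blast
  let ?W = "\<lambda>\<gamma>. restrict (w \<circ> \<gamma>) (topspace (top_of_set {0..1::real}))"
  have "continuous_map (subtopology (prod_topology X Y) A) (path_space Z') (?W \<circ> \<sigma>)"
    using \<sigma> continuous_map_compact_open_postcompose[OF w] unfolding path_space_def
    by (rule continuous_map_compose)
  moreover have "\<forall>(x, y) \<in> A. (?W \<circ> \<sigma>) (x, y) 0 = (w \<circ> f) x \<and> (?W \<circ> \<sigma>) (x, y) 1 = (w \<circ> g) y"
    using ends by auto
  ultimately show ?thesis
    using A unfolding sectional_def by blast
qed

lemma continuous_map_map_prod:
  assumes "continuous_map X' X u" and "continuous_map Y' Y v"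
  shows "continuous_map (prod_topology X' Y') (prod_topology X Y) (map_prod u v)"
  using assms continuous_map_prod_top[of X' Y' X Y u v]
  by (simp add: map_prod_def)

lemma sectional_precompose:
  assumes u: "continuous_map X' X u" and v: "continuous_map Y' Y v"
    and A: "sectional X Y Z f g A"
  shows "sectional X' Y' Z (f \<circ> u) (g \<circ> v) (map_prod u v -` A \<inter> topspace X' \<times> topspace Y')"
    (is "sectional _ _ _ _ _ ?A'")
proof -
  obtain \<sigma> where \<sigma>: "continuous_map (subtopology (prod_topology X Y) A) (path_space Z) \<sigma>"
    and ends: "\<forall>(x, y) \<in> A. \<sigma> (x, y) 0 = f x \<and> \<sigma> (x, y) 1 = g y"
    using A unfolding sectional_def by blast
  have "continuous_map (subtopology (prod_topology X' Y') ?A') (subtopology (prod_topology X Y) A)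
          (map_prod u v)"
    using continuous_map_map_prod[OF u v]
    by (auto simp: continuous_map_in_subtopology continuous_map_from_subtopology)
  then have "continuous_map (subtopology (prod_topology X' Y') ?A') (path_space Z)
      (\<sigma> \<circ> map_prod u v)"
    using \<sigma> by (rule continuous_map_compose)
  moreover have "\<forall>(x, y) \<in> ?A'. (\<sigma> \<circ> map_prod u v) (x, y) 0 = (f \<circ> u) x \<and>
      (\<sigma> \<circ> map_prod u v) (x, y) 1 = (g \<circ> v) y"
    using ends by auto
  ultimately show ?thesis
    unfolding sectional_def by blast
qed

lemma has_sectional_cover_postcompose:
  assumes "continuous_map Z Z' w" and "has_sectional_cover X Y Z f g k"
  shows "has_sectional_cover X Y Z' (w \<circ> f) (w \<circ> g) k"
  using assms(2) sectional_postcompose[OF assms(1), of X Y f g]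
  unfolding has_sectional_cover_def by meson

lemma has_sectional_cover_precompose:
  assumes u: "continuous_map X' X u" and v: "continuous_map Y' Y v"
    and "has_sectional_cover X Y Z f g k"
  shows "has_sectional_cover X' Y' Z (f \<circ> u) (g \<circ> v) k"
proof -
  obtain U where U: "\<And>i. i \<le> k \<Longrightarrow> openin (prod_topology X Y) (U i)"
      "\<And>i. i \<le> k \<Longrightarrow> sectional X Y Z f g (U i)"
    and cover: "topspace X \<times> topspace Y = (\<Union>i\<le>k. U i)"
    using assms(3) unfolding has_sectional_cover_def by blast
  define U' where "U' i = map_prod u v -` U i \<inter> topspace X' \<times> topspace Y'" for i
  have "openin (prod_topology X' Y') (U' i)" if "i \<le> k" for i
  proof -
    have "U' i = {p \<in> topspace (prod_topology X' Y'). map_prod u v p \<in> U i}"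
      by (auto simp: U'_def)
    then show ?thesis
      using openin_continuous_map_preimage[OF continuous_map_map_prod[OF u v] U(1)[OF that]]
      by simp
  qed
  moreover have "sectional X' Y' Z (f \<circ> u) (g \<circ> v) (U' i)" if "i \<le> k" for i
    unfolding U'_def using u v U(2)[OF that] by (rule sectional_precompose)
  moreover have "topspace X' \<times> topspace Y' = (\<Union>i\<le>k. U' i)"
  proof -
    have "map_prod u v ` (topspace X' \<times> topspace Y') \<subseteq> (\<Union>i\<le>k. U i)"
      unfolding cover[symmetric] using u v by (auto simp: continuous_map_def)
    then show ?thesis
      by (auto simp: U'_def image_subset_iff)
  qed
  ultimately show ?thesis
    unfolding has_sectional_cover_def by blast
qed

lemma TC_H_mono:
  assumes "\<And>k. has_sectional_cover X Y Z f g k \<Longrightarrow> has_sectional_cover X' Y' Z' f' g' k"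
  shows "TC_H X' Y' Z' f' g' \<le> TC_H X Y Z f g"
proof (cases "\<exists>k. has_sectional_cover X Y Z f g k")
  case True
  then have "has_sectional_cover X' Y' Z' f' g' (LEAST k. has_sectional_cover X Y Z f g k)"
    by (intro assms) (rule LeastI_ex)
  with True show ?thesis
    by (auto simp: TC_H_def intro: Least_le)
next
  case False
  then show ?thesis
    by (simp add: TC_H_def)
qed

theorem proposition8p6:
  fixes X :: "'a topology" and Y :: "'b topology" and Z :: "'c topology"
    and X' :: "'d topology" and Y' :: "'e topology" and Z' :: "'f topology"
    and f :: "'a \<Rightarrow> 'c" and g :: "'b \<Rightarrow> 'c"
  assumes "continuous_map X Z f" and "continuous_map Y Z g"
  shows "(\<forall>u v. continuous_map X' X u \<and> continuous_map Y' Y v \<longrightarrow>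
            TC_H X' Y' Z (f \<circ> u) (g \<circ> v) \<le> TC_H X Y Z f g) \<and>
         (\<forall>w. continuous_map Z Z' w \<longrightarrow>
            TC_H X Y Z' (w \<circ> f) (w \<circ> g) \<le> TC_H X Y Z f g)"
proof (intro conjI allI impI)
  fix u v
  assume "continuous_map X' X u \<and> continuous_map Y' Y v"
  then show "TC_H X' Y' Z (f \<circ> u) (g \<circ> v) \<le> TC_H X Y Z f g"
    by (intro TC_H_mono has_sectional_cover_precompose[of X' X u Y' Y v]) simp_all
next
  fix w
  assume "continuous_map Z Z' w"
  then show "TC_H X Y Z' (w \<circ> f) (w \<circ> g) \<le> TC_H X Y Z f g"
    by (intro TC_H_mono has_sectional_cover_postcompose)
qed

end
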